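(* For every integer $n\ge 1$, the Wiener index and the Mostar index of the Fibonacci cube $\Gamma_n$ are related by $$W(\Gamma_n)=\mathrm{Mo}(\Gamma_n)+\sum_{k=1}^{n}\left(f_k f_{n-k+1}\right)^2.$$
   Context: Fibonacci numbers: $f_0=0$, $f_1=1$, $f_n=f_{n-1}+f_{n-2}$ for $n\ge 2$. Fibonacci cube: for $n\ge 1$, $\Gamma_n$ is the graph whose vertices are the binary strings $b_1b_2\ldots b_n\in\{0,1\}^n$ with $b_i\cdot b_{i+1}=0$ for all $1\le i\le n-1$ (no two consecutive 1s), two vertices being adjacent if and only if they differ in exactly one coordinate (i.e. the subgraph of the $n$-dimensional hypercube induced by these strings). Mostar index: for a graph $G$ and an edge $uv\in E(G)$, $n_u(G)$ is the number of vertices of $G$ that are strictly closer (in the shortest path metric of $G$) to $u$ than to $v$, and $n_v(G)$ is the number of vertices strictly closer to $v$ than to $u$. The Mostar index is $\mathrm{Mo}(G)=\sum_{uv\in E(G)}|n_u(G)-n_v(G)|$, the sum being over (unordered) edges. Wiener index: for a connected graph $G$, $W(G)$ is the sum of the shortest path distances $d(u,v)$ over all unordered pairs $\{u,v\}$ of vertices of $G$. *)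

theory Defs
  imports "HOL-Number_Theory.Fib"
begin

record 'a graph =
  verts :: "'a set"
  edges :: "'a set set"

definition simple_graph :: "'a graph \<Rightarrow> bool" where
  "simple_graph G \<longleftrightarrow> finite (verts G) \<and> (\<forall>e\<in>edges G. e \<subseteq> verts G \<and> card e = 2)"

definition adj :: "'a graph \<Rightarrow> ('a \<times> 'a) set" where
  "adj G = {(u, v). {u, v} \<in> edges G}"

definition connected_graph :: "'a graph \<Rightarrow> bool" where
  "connected_graph G \<longleftrightarrow> (\<forall>u\<in>verts G. \<forall>v\<in>verts G. (u, v) \<in> (adj G)\<^sup>*)"

(* (u, v) \<in> adj G ^^ k says that there is a walk of length k from u to v.
   If no walk exists the value is unspecified, but it is the same for all such pairs. *)
definition gdist :: "'a graph \<Rightarrow> 'a \<Rightarrow> 'a \<Rightarrow> nat" where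
  "gdist G u v = (LEAST k. (u, v) \<in> adj G ^^ k)"

definition n_closer :: "'a graph \<Rightarrow> 'a \<Rightarrow> 'a \<Rightarrow> nat" where
  "n_closer G u v = card {w \<in> verts G. gdist G w u < gdist G w v}"

(* The value of a symmetric f at the unordered pair p = {u, v}; see on_pair_eq. *)
definition on_pair :: "('a \<Rightarrow> 'a \<Rightarrow> 'b) \<Rightarrow> 'a set \<Rightarrow> 'b" where
  "on_pair f p = (THE d. \<exists>u v. p = {u, v} \<and> d = f u v)"

definition mostar_index :: "'a graph \<Rightarrow> int" where
  "mostar_index G =
     (\<Sum>e\<in>edges G. on_pair (\<lambda>u v. \<bar>int (n_closer G u v) - int (n_closer G v u)\<bar>) e)"

definition wiener_index :: "'a graph \<Rightarrow> nat" where
  "wiener_index G = (\<Sum>p\<in>{p. p \<subseteq> verts G \<and> card p = 2}. on_pair (gdist G) p)"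

(* Strings are 0-indexed lists, True standing for 1. *)
definition fib_strings :: "nat \<Rightarrow> bool list set" where
  "fib_strings n = {b. length b = n \<and> (\<forall>i. Suc i < n \<longrightarrow> \<not> (b ! i \<and> b ! Suc i))}"

definition fib_cube :: "nat \<Rightarrow> bool list graph" where
  "fib_cube n =
     \<lparr>verts = fib_strings n,
      edges = {{b, c} | b c. b \<in> fib_strings n \<and> c \<in> fib_strings n \<and>
                             card {i. i < n \<and> b ! i \<noteq> c ! i} = 1}\<rparr>"

lemma on_pair_eq:
  assumes "\<And>u v. f u v = f v u"
  shows "on_pair f {u, v} = f u v"
  unfolding on_pair_def using assms by (intro the_equality) (auto simp: doubleton_eq_iff)

lemma sym_adj: "sym (adj G)"
  by (auto simp: sym_def adj_def insert_commute)

lemma gdist_commute: "gdist G u v = gdist G v u"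
proof -
  have *: "(b, a) \<in> adj G ^^ k" if "(a, b) \<in> adj G ^^ k" for a b k
    using that
  proof (induction k arbitrary: b)
    case 0
    then show ?case by simp
  next
    case (Suc k)
    then obtain c where "(a, c) \<in> adj G ^^ k" "(c, b) \<in> adj G" by auto
    with Suc.IH sym_adj[of G] show ?case
      by (blast intro: relpow_Suc_I2 dest: symD)
  qed
  then have "(u, v) \<in> adj G ^^ k \<longleftrightarrow> (v, u) \<in> adj G ^^ k" for k by blast
  then show ?thesis unfolding gdist_def by simp
qed

lemma on_pair_gdist: "on_pair (gdist G) {u, v} = gdist G u v"
  by (rule on_pair_eq) (rule gdist_commute)

lemma finite_fib_strings: "finite (fib_strings n)"
  by (rule finite_subset[OF _ finite_lists_length_eq[of UNIV n]]) (auto simp: fib_strings_def)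

lemma simple_graph_fib_cube: "simple_graph (fib_cube n)"
  unfolding simple_graph_def
proof (intro conjI ballI)
  show "finite (verts (fib_cube n))" by (simp add: fib_cube_def finite_fib_strings)
next
  fix e assume "e \<in> edges (fib_cube n)"
  then obtain b c where e: "e = {b, c}" "b \<in> fib_strings n" "c \<in> fib_strings n"
    "card {i. i < n \<and> b ! i \<noteq> c ! i} = 1"
    by (auto simp: fib_cube_def)
  then have "b \<noteq> c" by auto
  with e show "e \<subseteq> verts (fib_cube n)" "card e = 2" by (auto simp: fib_cube_def)
qed

lemma connected_fib_cube: "connected_graph (fib_cube n)"
proof -
  let ?z = "replicate n False"
  have to_zero: "(b, ?z) \<in> (adj (fib_cube n))\<^sup>*" if "b \<in> fib_strings n" for b
    using that
  proof (induction "card {i. i < n \<and> b ! i}" arbitrary: b rule: less_induct)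
    case less
    then have len: "length b = n" by (simp add: fib_strings_def)
    show ?case
    proof (cases "\<exists>i<n. b ! i")
      case False
      then have "b = ?z" using len by (auto intro: nth_equalityI)
      then show ?thesis by simp
    next
      case True
      then obtain j where j: "j < n" "b ! j" by blast
      define c where "c = b[j := False]"
      have c: "c \<in> fib_strings n"
        unfolding fib_strings_def
      proof (intro CollectI conjI allI impI)
        show "length c = n" using len by (simp add: c_def)
        fix i assume i: "Suc i < n"
        with less.prems have "\<not> (b ! i \<and> b ! Suc i)" by (simp add: fib_strings_def)
        with j len show "\<not> (c ! i \<and> c ! Suc i)" by (auto simp: c_def nth_list_update Suc_lessD)
      qed
      have "{i. i < n \<and> c ! i} \<subset> {i. i < n \<and> b ! i}"
        using j len by (auto simp: c_def nth_list_update split: if_splits)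
      then have "card {i. i < n \<and> c ! i} < card {i. i < n \<and> b ! i}"
        by (simp add: psubset_card_mono)
      from less.hyps[OF this c] have "(c, ?z) \<in> (adj (fib_cube n))\<^sup>*" .
      moreover have "{i. i < n \<and> b ! i \<noteq> c ! i} = {j}"
        using j len by (auto simp: c_def nth_list_update)
      then have "(b, c) \<in> adj (fib_cube n)"
        unfolding adj_def fib_cube_def graph.simps mem_Collect_eq prod.case
        using less.prems c by (intro exI[of _ b] exI[of _ c]) simp
      ultimately show ?thesis by (rule converse_rtrancl_into_rtrancl[rotated])
    qed
  qed
  have "(u, v) \<in> (adj (fib_cube n))\<^sup>*" if "u \<in> fib_strings n" "v \<in> fib_strings n" for u v
    using to_zero[OF that(1)] symD[OF sym_rtrancl[OF sym_adj] to_zero[OF that(2)]]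
    by (rule rtrancl_trans)
  then show ?thesis by (simp add: connected_graph_def fib_cube_def)
qed

end

theory Submission
  imports Defs
begin

text \<open>
  The Fibonacci cube is an isometric subgraph of the hypercube: its path metric is the Hamming
  distance. Both indices therefore split into contributions of the single coordinates. Fix a
  coordinate, and let \<open>A\<close> be the number of Fibonacci strings with a 1 there and \<open>B\<close> the number of
  those with a 0 there.

  The coordinate adds 1 to the distance of exactly the \<open>A * B\<close> pairs that it separates, so it
  contributes \<open>A * B\<close> to the Wiener index. An edge in its direction joins a string with a 1 there to
  the result of clearing that 1; clearing never leaves the set of Fibonacci strings, so there are
  \<open>A\<close> such edges. The vertices closer to one end of the edge are those that agree with this end in
  the coordinate, so each such edge contributes \<open>\<bar>A - B\<bar>\<close> to the Mostar index, and this is \<open>B - A\<close>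
  because clearing is injective on the strings with a 1 there. The difference of the two contributions is
  \<open>A * B - A * (B - A) = A\<^sup>2\<close>.

  Finally, a 1 in position \<open>k\<close> cuts the string into two independent pieces, neither of which has
  a 1 next to the cut; this gives \<open>A = fib k * fib (n - k + 1)\<close>.
\<close>

section \<open>The path metric of the Fibonacci cube\<close>

definition hamming :: "nat \<Rightarrow> 'a list \<Rightarrow> 'a list \<Rightarrow> nat" where
  "hamming n b c = card {i. i < n \<and> b ! i \<noteq> c ! i}"

lemma hamming_commute: "hamming n b c = hamming n c b"
  by (simp add: hamming_def eq_commute)

lemma hamming_refl [simp]: "hamming n b b = 0"
  by (simp add: hamming_def)

lemma hamming_triangle: "hamming n b d \<le> hamming n b c + hamming n c d"
proof -
  have "hamming n b d \<le> card ({i. i < n \<and> b ! i \<noteq> c ! i} \<union> {i. i < n \<and> c ! i \<noteq> d ! i})"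
    unfolding hamming_def by (rule card_mono) auto
  also have "\<dots> \<le> hamming n b c + hamming n c d"
    unfolding hamming_def by (rule card_Un_le)
  finally show ?thesis .
qed

lemma verts_fib_cube [simp]: "verts (fib_cube n) = fib_strings n"
  by (simp add: fib_cube_def)

lemma adj_fib_cube_iff:
  "(b, c) \<in> adj (fib_cube n) \<longleftrightarrow> b \<in> fib_strings n \<and> c \<in> fib_strings n \<and> hamming n b c = 1"
proof -
  have "(b, c) \<in> adj (fib_cube n) \<longleftrightarrow>
      (\<exists>u v. {b, c} = {u, v} \<and> u \<in> fib_strings n \<and> v \<in> fib_strings n \<and> hamming n u v = 1)"
    unfolding adj_def fib_cube_def hamming_def by simp
  then show ?thesis
    by (auto simp: doubleton_eq_iff hamming_commute)
qed

lemma fib_strings_clear: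
  assumes "b \<in> fib_strings n"
  shows "b[i := False] \<in> fib_strings n"
  unfolding fib_strings_def
proof (intro CollectI conjI allI impI)
  show "length (b[i := False]) = n" using assms by (simp add: fib_strings_def)
  fix j assume "Suc j < n"
  moreover have "b ! k" if "b[i := False] ! k" for k
    using that by (metis linorder_not_less list_update_beyond nth_list_update_eq nth_list_update_neq)
  ultimately show "\<not> (b[i := False] ! j \<and> b[i := False] ! Suc j)"
    using assms by (auto simp: fib_strings_def)
qed

lemma differ_clear:
  assumes "b \<in> fib_strings n" "i < n" "b ! i"
  shows "{j. j < n \<and> b ! j \<noteq> b[i := False] ! j} = {i}"
  using assms by (auto simp: fib_strings_def nth_list_update)

lemma adj_clear:
  assumes "b \<in> fib_strings n" "i < n" "b ! i"
  shows "(b, b[i := False]) \<in> adj (fib_cube n)"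
  using assms differ_clear[OF assms] by (simp add: adj_fib_cube_iff fib_strings_clear hamming_def)

lemma hamming_clear:
  assumes "b \<in> fib_strings n" "i < n" "b ! i" "\<not> c ! i"
  shows "hamming n b c = Suc (hamming n (b[i := False]) c)"
proof -
  have "{j. j < n \<and> b ! j \<noteq> c ! j} = insert i {j. j < n \<and> b[i := False] ! j \<noteq> c ! j}"
    using assms by (auto simp: fib_strings_def nth_list_update split: if_splits)
  moreover have "i \<notin> {j. j < n \<and> b[i := False] ! j \<noteq> c ! j}"
    using assms by (auto simp: fib_strings_def)
  ultimately show ?thesis by (simp add: hamming_def)
qed

lemma hamming_le_walk:
  assumes "(b, c) \<in> adj (fib_cube n) ^^ k"
  shows "hamming n b c \<le> k"
  using assms
proof (induction k arbitrary: c)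
  case (Suc k)
  then obtain d where d: "(b, d) \<in> adj (fib_cube n) ^^ k" "(d, c) \<in> adj (fib_cube n)" by auto
  have "hamming n b c \<le> hamming n b d + hamming n d c" by (rule hamming_triangle)
  with Suc.IH[OF d(1)] d(2) show ?case by (simp add: adj_fib_cube_iff)
qed simp

text \<open>
  A geodesic of the hypercube that turns a 0 into a 1 may leave the Fibonacci strings. Clearing
  ones is always possible, though, so the walk is built from both ends: at a coordinate where the
  strings differ, the one that has the 1 there is moved.
\<close>

lemma walk_of_length_hamming:
  assumes "b \<in> fib_strings n" "c \<in> fib_strings n"
  shows "(b, c) \<in> adj (fib_cube n) ^^ hamming n b c"
  using assms
proof (induction "hamming n b c" arbitrary: b c)
  case 0
  then have "\<And>i. i < n \<Longrightarrow> b ! i = c ! i" by (auto simp: hamming_def)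
  with 0 have "b = c" by (auto simp: fib_strings_def intro: nth_equalityI)
  then show ?case by simp
next
  case (Suc m)
  have "card {i. i < n \<and> b ! i \<noteq> c ! i} \<noteq> 0"
    unfolding hamming_def[symmetric] Suc.hyps(2)[symmetric] by simp
  then have "{i. i < n \<and> b ! i \<noteq> c ! i} \<noteq> {}" by (intro notI) (simp only: card.empty)
  then obtain i where i: "i < n" "b ! i \<noteq> c ! i" by blast
  show ?case
  proof (cases "b ! i")
    case True
    have h: "hamming n b c = Suc (hamming n (b[i := False]) c)"
      using hamming_clear Suc.prems i True by blast
    then have "(b[i := False], c) \<in> adj (fib_cube n) ^^ m"
      using Suc by (metis fib_strings_clear nat.inject)
    with adj_clear[OF Suc.prems(1) i(1) True] show ?thesis
      unfolding Suc.hyps(2)[symmetric] by (rule relpow_Suc_I2)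
  next
    case False
    with i have ci: "c ! i" by simp
    have h: "hamming n b c = Suc (hamming n b (c[i := False]))"
      using hamming_clear[OF Suc.prems(2) i(1) ci False] by (simp add: hamming_commute)
    then have "(b, c[i := False]) \<in> adj (fib_cube n) ^^ m"
      using Suc by (metis fib_strings_clear nat.inject)
    moreover have "(c[i := False], c) \<in> adj (fib_cube n)"
      using adj_clear[OF Suc.prems(2) i(1) ci] sym_adj by (metis symD)
    ultimately show ?thesis
      unfolding Suc.hyps(2)[symmetric] by (rule relpow_Suc_I)
  qed
qed

lemma gdist_fib_cube:
  assumes "b \<in> fib_strings n" "c \<in> fib_strings n"
  shows "gdist (fib_cube n) b c = hamming n b c"
  unfolding gdist_def
  by (rule Least_equality) (simp_all add: walk_of_length_hamming[OF assms] hamming_le_walk)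

section \<open>Splitting the indices by coordinates\<close>

definition ones :: "nat \<Rightarrow> nat \<Rightarrow> bool list set" where
  "ones n i = {b \<in> fib_strings n. b ! i}"

definition zeros :: "nat \<Rightarrow> nat \<Rightarrow> bool list set" where
  "zeros n i = {b \<in> fib_strings n. \<not> b ! i}"

lemma finite_ones [simp]: "finite (ones n i)" and finite_zeros [simp]: "finite (zeros n i)"
  by (simp_all add: ones_def zeros_def finite_fib_strings)

lemma ones_zeros_disjoint: "ones n i \<inter> zeros n i = {}"
  by (auto simp: ones_def zeros_def)

lemma card_transversal_pairs:
  assumes "A \<inter> B = {}"
  shows "card {{u, v} | u v. u \<in> A \<and> v \<in> B} = card A * card B"
proof -
  have "{{u, v} | u v. u \<in> A \<and> v \<in> B} = (\<lambda>(u, v). {u, v}) ` (A \<times> B)" by auto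
  moreover have "inj_on (\<lambda>(u, v). {u, v}) (A \<times> B)"
    using assms by (auto simp: inj_on_def doubleton_eq_iff)
  ultimately show ?thesis by (simp add: card_image card_cartesian_product)
qed

text \<open>Double counting: a pair contributes one for each coordinate that separates it.\<close>

lemma wiener_index_fib_cube:
  "wiener_index (fib_cube n) = (\<Sum>i<n. card (ones n i) * card (zeros n i))"
proof -
  let ?P = "{p. p \<subseteq> fib_strings n \<and> card p = 2}"
  let ?S = "\<lambda>i. {{u, v} | u v. u \<in> ones n i \<and> v \<in> zeros n i}"
  have fin: "finite ?P"
    by (rule finite_subset[of _ "Pow (fib_strings n)"]) (auto simp: finite_fib_strings)
  have dist: "on_pair (gdist (fib_cube n)) p = (\<Sum>i<n. if p \<in> ?S i then 1 else 0)"
    if "p \<in> ?P" for p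
  proof -
    from that obtain u v where p: "p = {u, v}" and uv: "u \<in> fib_strings n" "v \<in> fib_strings n"
      by (auto simp: card_2_iff)
    have "p \<in> ?S i \<longleftrightarrow> u ! i \<noteq> v ! i" for i
      using uv unfolding p ones_def zeros_def by (auto simp: doubleton_eq_iff)
    moreover have "on_pair (gdist (fib_cube n)) p = card {i. i < n \<and> u ! i \<noteq> v ! i}"
      unfolding p on_pair_gdist gdist_fib_cube[OF uv] hamming_def ..
    ultimately show ?thesis
      by (simp add: sum.If_cases lessThan_def Int_def)
  qed
  have sub: "?S i \<subseteq> ?P" for i
    using ones_zeros_disjoint[of n i] by (auto simp: ones_def zeros_def card_2_iff)
  have "wiener_index (fib_cube n) = (\<Sum>p\<in>?P. \<Sum>i<n. if p \<in> ?S i then 1 else 0)"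
    unfolding wiener_index_def verts_fib_cube by (rule sum.cong[OF refl dist])
  also have "\<dots> = (\<Sum>i<n. \<Sum>p\<in>?P. if p \<in> ?S i then 1 else 0)"
    by (rule sum.swap)
  also have "\<dots> = (\<Sum>i<n. card (?S i))"
  proof (rule sum.cong[OF refl])
    fix i
    have "(\<Sum>p\<in>?P. if p \<in> ?S i then 1 else 0) = card (?P \<inter> ?S i)"
      using fin by (subst sum.inter_restrict[symmetric]) simp_all
    then show "(\<Sum>p\<in>?P. if p \<in> ?S i then 1 else 0) = card (?S i)"
      using sub[of i] by (simp add: Int_absorb1)
  qed
  finally show ?thesis
    by (simp add: card_transversal_pairs[OF ones_zeros_disjoint])
qed

lemma closer_across_edge:
  assumes "u \<in> ones n i" "i < n"
  defines "v \<equiv> u[i := False]"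
  shows "n_closer (fib_cube n) u v = card (ones n i)"
    and "n_closer (fib_cube n) v u = card (zeros n i)"
proof -
  have u: "u \<in> fib_strings n" "u ! i" using assms by (auto simp: ones_def)
  have v: "v \<in> fib_strings n" using u by (simp add: v_def fib_strings_clear)
  have *: "hamming n w v = Suc (hamming n w u) \<and> w ! i \<or> hamming n w u = Suc (hamming n w v) \<and> \<not> w ! i"
    for w :: "bool list"
  proof -
    define D where "D = {j. j < n \<and> j \<noteq> i \<and> w ! j \<noteq> u ! j}"
    have "{j. j < n \<and> w ! j \<noteq> u ! j} = (if w ! i then D else insert i D)"
      and "{j. j < n \<and> w ! j \<noteq> v ! j} = (if w ! i then insert i D else D)"
      using u assms(2) by (auto simp: D_def v_def fib_strings_def nth_list_update)
    moreover have "finite D" "i \<notin> D" by (auto simp: D_def)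
    ultimately show ?thesis by (simp add: hamming_def)
  qed
  have "{w \<in> fib_strings n. gdist (fib_cube n) w u < gdist (fib_cube n) w v} = ones n i"
    unfolding ones_def using * gdist_fib_cube[OF _ u(1)] gdist_fib_cube[OF _ v]
    by (metis (mono_tags, lifting) lessI not_less_iff_gr_or_eq)
  then show "n_closer (fib_cube n) u v = card (ones n i)" by (simp add: n_closer_def)
  have "{w \<in> fib_strings n. gdist (fib_cube n) w v < gdist (fib_cube n) w u} = zeros n i"
    unfolding zeros_def using * gdist_fib_cube[OF _ u(1)] gdist_fib_cube[OF _ v]
    by (metis (mono_tags, lifting) lessI not_less_iff_gr_or_eq)
  then show "n_closer (fib_cube n) v u = card (zeros n i)" by (simp add: n_closer_def)
qed

text \<open>
  An edge is determined by its coordinate and by the end that has a 1 there, and every choice of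
  these data gives an edge.
\<close>

lemma edges_fib_cube_bij:
  "bij_betw (\<lambda>(i, u). {u, u[i := False]}) (SIGMA i:{..<n}. ones n i) (edges (fib_cube n))"
proof (rule bij_betwI')
  fix x y assume "x \<in> (SIGMA i:{..<n}. ones n i)" "y \<in> (SIGMA i:{..<n}. ones n i)"
  then obtain i u j v where xy: "x = (i, u)" "y = (j, v)" "i < n" "j < n"
    and u: "u \<in> fib_strings n" "u ! i" and v: "v \<in> fib_strings n" "v ! j"
    by (auto simp: ones_def)
  have len: "length u = n" "length v = n" using u v by (auto simp: fib_strings_def)
  have "i = j \<and> u = v" if eq: "{u, u[i := False]} = {v, v[j := False]}"
  proof (cases "u = v")
    case True
    with eq have "u[i := False] = u[j := False]" by (auto simp: doubleton_eq_iff)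
    with True u xy len show ?thesis by (metis nth_list_update_eq nth_list_update_neq)
  next
    case False
    with eq have "u = v[j := False]" "v = u[i := False]" by (auto simp: doubleton_eq_iff)
    \<comment> \<open>Passing from \<open>v\<close> to \<open>u\<close> and back only clears entries, so the 1 of \<open>v\<close> at \<open>j\<close> is lost.\<close>
    then have "\<not> v ! j" using xy len by (metis nth_list_update_eq nth_list_update_neq)
    with v show ?thesis by simp
  qed
  then show "((case x of (i, u) \<Rightarrow> {u, u[i := False]}) = (case y of (i, u) \<Rightarrow> {u, u[i := False]}))
      = (x = y)"
    by (auto simp: xy)
next
  fix x assume "x \<in> (SIGMA i:{..<n}. ones n i)"
  then show "(case x of (i, u) \<Rightarrow> {u, u[i := False]}) \<in> edges (fib_cube n)"
    using adj_clear by (auto simp: ones_def adj_def)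
next
  fix e assume "e \<in> edges (fib_cube n)"
  then obtain b c where e: "e = {b, c}" and bc: "b \<in> fib_strings n" "c \<in> fib_strings n"
    and "card {i. i < n \<and> b ! i \<noteq> c ! i} = 1"
    by (auto simp: fib_cube_def)
  then obtain i where i: "{i. i < n \<and> b ! i \<noteq> c ! i} = {i}" by (auto simp: card_1_singleton_iff)
  have in_: "i < n" "b ! i \<noteq> c ! i" using i by auto
  have eq: "b ! j = c ! j" if "j < n" "j \<noteq> i" for j using i that by auto
  have len: "length b = n" "length c = n" using bc by (auto simp: fib_strings_def)
  have "\<exists>u\<in>ones n i. e = {u, u[i := False]}"
  proof (cases "b ! i")
    case True
    have "c ! j = b[i := False] ! j" if "j < n" for j
      using that True in_ len eq[of j] by (cases "j = i") simp_all
    then have "c = b[i := False]" using len by (simp add: nth_equalityI)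
    with True e bc show ?thesis by (auto simp: ones_def)
  next
    case False
    have "b ! j = c[i := False] ! j" if "j < n" for j
      using that False in_ len eq[of j] by (cases "j = i") simp_all
    then have "b = c[i := False]" using len by (simp add: nth_equalityI)
    with False in_ e bc show ?thesis by (auto simp: ones_def)
  qed
  then show "\<exists>x\<in>SIGMA i:{..<n}. ones n i. e = (case x of (i, u) \<Rightarrow> {u, u[i := False]})"
    using in_ by auto
qed

lemma mostar_index_fib_cube:
  "mostar_index (fib_cube n) =
     (\<Sum>i<n. int (card (ones n i)) * \<bar>int (card (ones n i)) - int (card (zeros n i))\<bar>)"
proof -
  let ?f = "\<lambda>u v. \<bar>int (n_closer (fib_cube n) u v) - int (n_closer (fib_cube n) v u)\<bar>"
  have "mostar_index (fib_cube n) =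
      (\<Sum>(i, u)\<in>(SIGMA i:{..<n}. ones n i). on_pair ?f {u, u[i := False]})"
    unfolding mostar_index_def sum.reindex_bij_betw[OF edges_fib_cube_bij, symmetric]
    by (simp add: case_prod_beta)
  also have "\<dots> = (\<Sum>i<n. \<Sum>u\<in>ones n i. on_pair ?f {u, u[i := False]})"
    by (simp add: sum.Sigma)
  also have "\<dots> = (\<Sum>i<n. \<Sum>u\<in>ones n i. \<bar>int (card (ones n i)) - int (card (zeros n i))\<bar>)"
  proof (intro sum.cong refl)
    fix i u assume "i \<in> {..<n}" "u \<in> ones n i"
    then have "?f u (u[i := False]) = \<bar>int (card (ones n i)) - int (card (zeros n i))\<bar>"
      by (simp add: closer_across_edge)
    moreover have "on_pair ?f {u, u[i := False]} = ?f u (u[i := False])"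
      by (rule on_pair_eq) (rule abs_minus_commute)
    ultimately show
      "on_pair ?f {u, u[i := False]} = \<bar>int (card (ones n i)) - int (card (zeros n i))\<bar>" by simp
  qed
  finally show ?thesis by simp
qed

lemma card_ones_le_zeros:
  assumes "i < n"
  shows "card (ones n i) \<le> card (zeros n i)"
proof (rule card_inj_on_le[where f = "\<lambda>u. u[i := False]"])
  show "inj_on (\<lambda>u. u[i := False]) (ones n i)"
  proof (rule inj_onI)
    fix u v assume uv: "u \<in> ones n i" "v \<in> ones n i" and eq: "u[i := False] = v[i := False]"
    have "w[i := False, i := True] = w" if "w \<in> ones n i" for w
      using that by (metis (mono_tags, lifting) list_update_id list_update_overwrite mem_Collect_eq ones_def)
    with uv eq show "u = v" by metis
  qed
  show "(\<lambda>u. u[i := False]) ` ones n i \<subseteq> zeros n i"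
    using assms fib_strings_clear by (fastforce simp: ones_def zeros_def fib_strings_def)
qed simp

section \<open>Counting the strings with a given 1\<close>

abbreviation no_11 :: "bool list \<Rightarrow> bool" where
  "no_11 \<equiv> successively (\<lambda>x y. \<not> (x \<and> y))"

lemma fib_strings_eq: "fib_strings n = {b. length b = n \<and> no_11 b}"
  by (auto simp: fib_strings_def successively_conv_nth)

lemma card_fib_strings: "card (fib_strings n) = fib (n + 2)"
  and card_after_one: "card {s. length s = n \<and> no_11 (True # s)} = fib (n + 1)"
proof (induction n)
  case 0
  have "{s :: bool list. length s = 0 \<and> no_11 (True # s)} = {[]}" by auto
  moreover have "fib_strings 0 = {[]}" by (auto simp: fib_strings_eq)
  ultimately show "card (fib_strings 0) = fib (0 + 2)"
    "card {s. length s = 0 \<and> no_11 (True # s)} = fib (0 + 1)" by simp_all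
next
  case (Suc n)
  let ?H = "\<lambda>n. {s. length s = n \<and> no_11 (True # s)}"
  have H: "?H (Suc n) = (#) False ` fib_strings n"
    by (auto simp: fib_strings_eq length_Suc_conv successively_Cons image_iff)
  show H': "card (?H (Suc n)) = fib (Suc n + 1)"
    unfolding H using Suc by (simp add: card_image)
  have "fib_strings (Suc n) = (#) False ` fib_strings n \<union> (#) True ` ?H n"
    by (auto simp: fib_strings_eq length_Suc_conv successively_Cons image_iff)
  moreover have "finite (?H n)"
    by (rule finite_subset[OF _ finite_lists_length_eq[of UNIV n]]) auto
  moreover have "(#) False ` fib_strings n \<inter> (#) True ` ?H n = {}" by auto
  ultimately have "card (fib_strings (Suc n)) =
      card ((#) False ` fib_strings n) + card ((#) True ` ?H n)"
    by (simp only: card_Un_disjoint finite_imageI finite_fib_strings)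
  then have "card (fib_strings (Suc n)) = card (fib_strings n) + card (?H n)"
    by (simp only: card_image inj_on_Cons1)
  with Suc show "card (fib_strings (Suc n)) = fib (Suc n + 2)" by simp
qed

text \<open>
  Reversing does not affect the absence of adjacent ones, so the prefix before the 1, read
  backwards, is counted in the same way as the suffix after it.
\<close>

lemma card_ones:
  assumes "i < n"
  shows "card (ones n i) = fib (i + 1) * fib (n - i)"
proof -
  let ?H = "\<lambda>n. {s. length s = n \<and> no_11 (True # s)}"
  let ?f = "\<lambda>(p, s). rev p @ True # s"
  have "bij_betw ?f (?H i \<times> ?H (n - 1 - i)) (ones n i)"
  proof (rule bij_betw_imageI)
    show "inj_on ?f (?H i \<times> ?H (n - 1 - i))" by (auto simp: inj_on_def)
    have split: "no_11 (rev p @ True # s) \<longleftrightarrow> no_11 (True # p) \<and> no_11 (True # s)" for p s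
    proof -
      have "no_11 (rev p @ True # s) \<longleftrightarrow>
          no_11 (rev p) \<and> no_11 (True # s) \<and> (p = [] \<or> \<not> hd p)"
        by (cases "p = []") (simp_all add: successively_append_iff last_rev)
      moreover have "no_11 (rev p) \<longleftrightarrow> no_11 p"
        unfolding successively_rev by (simp only: conj_commute)
      moreover have "no_11 (True # p) \<longleftrightarrow> no_11 p \<and> (p = [] \<or> \<not> hd p)"
        by (cases p) auto
      ultimately show ?thesis by blast
    qed
    show "?f ` (?H i \<times> ?H (n - 1 - i)) = ones n i"
    proof (intro equalityI subsetI)
      fix b assume "b \<in> ?f ` (?H i \<times> ?H (n - 1 - i))"
      then obtain p s where ps: "b = rev p @ True # s" "p \<in> ?H i" "s \<in> ?H (n - 1 - i)" by auto
      then have "no_11 b" using split[of p s] by simp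
      then show "b \<in> ones n i"
        using assms ps by (auto simp: ones_def fib_strings_eq nth_append)
    next
      fix b assume "b \<in> ones n i"
      then have b: "length b = n" "no_11 b" "b ! i" by (auto simp: ones_def fib_strings_eq)
      have il: "i < length b" and bi: "b ! i = True" using assms b by simp_all
      have eq: "b = ?f (rev (take i b), drop (Suc i) b)"
        unfolding prod.case rev_rev_ident by (rule id_take_nth_drop[OF il, unfolded bi])
      with b(2) have "no_11 (True # rev (take i b)) \<and> no_11 (True # drop (Suc i) b)"
        by (metis case_prod_conv split)
      then have "(rev (take i b), drop (Suc i) b) \<in> ?H i \<times> ?H (n - 1 - i)"
        using b(1) assms by simp
      with eq show "b \<in> ?f ` (?H i \<times> ?H (n - 1 - i))" by (rule image_eqI)
    qed
  qed
  then have "card (ones n i) = card (?H i \<times> ?H (n - 1 - i))" by (simp add: bij_betw_same_card)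
  also have "\<dots> = fib (i + 1) * fib (n - 1 - i + 1)"
    by (simp only: card_cartesian_product card_after_one)
  also have "n - 1 - i + 1 = n - i" using assms by simp
  finally show ?thesis .
qed

section \<open>Comparing the two indices\<close>

theorem mainTheorem4:
  fixes n :: nat
  assumes "n \<ge> 1"
  shows "int (wiener_index (fib_cube n)) =
           mostar_index (fib_cube n) + (\<Sum>k=1..n. (int (fib k * fib (n - k + 1)))\<^sup>2)"
proof -
  have "int (wiener_index (fib_cube n)) =
      (\<Sum>i<n. int (card (ones n i)) * int (card (zeros n i)))"
    by (simp add: wiener_index_fib_cube)
  also have "\<dots> = (\<Sum>i<n. int (card (ones n i)) * \<bar>int (card (ones n i)) - int (card (zeros n i))\<bar>
      + (int (card (ones n i)))\<^sup>2)"
  proof (rule sum.cong[OF refl])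
    fix i assume "i \<in> {..<n}"
    then have "card (ones n i) \<le> card (zeros n i)" by (simp add: card_ones_le_zeros)
    then show "int (card (ones n i)) * int (card (zeros n i)) =
        int (card (ones n i)) * \<bar>int (card (ones n i)) - int (card (zeros n i))\<bar>
        + (int (card (ones n i)))\<^sup>2"
      by (simp add: power2_eq_square algebra_simps)
  qed
  also have "\<dots> = mostar_index (fib_cube n) + (\<Sum>i<n. (int (card (ones n i)))\<^sup>2)"
    by (simp add: sum.distrib mostar_index_fib_cube)
  also have "(\<Sum>i<n. (int (card (ones n i)))\<^sup>2) = (\<Sum>k=1..n. (int (fib k * fib (n - k + 1)))\<^sup>2)"
    \<comment> \<open>List positions start at 0, so position \<open>i\<close> is the coordinate \<open>k = i + 1\<close>.\<close>
    by (rule sum.reindex_bij_witness[of _ "\<lambda>k. k - 1" Suc]) (auto simp: card_ones Suc_diff_Suc)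
  finally show ?thesis .
qed

end
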